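(* Let $n=p_1p_2p_3$, where $p_1<p_2<p_3$ are primes. Then $\alpha\bigl(\Theta(\mathbb{Z}_n)\bigr)=p_1(p_2-1)(p_3-1)$.
   Context: $\mathbb{Z}_n$ denotes the cyclic group of order $n$. For a finite group $G$, $|g|$ denotes the order of $g\in G$, and the prime-coprime graph $\Theta(G)$ is the simple graph with vertex set $G$ in which two distinct vertices $g,h$ are adjacent if and only if $\gcd(|g|,|h|)$ is either $1$ or a prime. The independence number $\alpha(\Gamma)$ of a graph $\Gamma$ is the maximum cardinality of an independent set of $\Gamma$. *)

theory Defs
  imports
    "HOL-Computational_Algebra.Primes"
    "HOL-Algebra.Elementary_Groups"
    "HOL-Algebra.Multiplicative_Group"
    "Graph_Theory.Graph_Theory"
begin

text \<open>An undirected edge between \<open>g\<close> and \<open>h\<close> is represented by the two arcs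
  \<open>(g, h)\<close> and \<open>(h, g)\<close>; finite simple graphs are the instances of \<^locale>\<open>pair_graph\<close>.\<close>

definition prime_coprime_graph :: "('a, 'b) monoid_scheme \<Rightarrow> 'a pair_pre_digraph" where
  "prime_coprime_graph G =
     \<lparr> pverts = carrier G,
       parcs = {(g, h). g \<in> carrier G \<and> h \<in> carrier G \<and> g \<noteq> h \<and>
                  (gcd (group.ord G g) (group.ord G h) = 1 \<or>
                   prime (gcd (group.ord G g) (group.ord G h)))} \<rparr>"

lemma pair_graph_prime_coprime_graph:
  assumes "finite (carrier G)"
  shows "pair_graph (prime_coprime_graph G)"
proof
  have "parcs (prime_coprime_graph G) \<subseteq> carrier G \<times> carrier G"
    by (auto simp: prime_coprime_graph_def)
  with assms show "finite (parcs (prime_coprime_graph G))"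
    by (meson finite_SigmaI finite_subset)
  show "symmetric (with_proj (prime_coprime_graph G))"
    by (auto simp: symmetric_def prime_coprime_graph_def gcd.commute intro!: symI)
qed (use assms in \<open>auto simp: prime_coprime_graph_def\<close>)

definition independent_set :: "'a pair_pre_digraph \<Rightarrow> 'a set \<Rightarrow> bool" where
  "independent_set G S \<longleftrightarrow> S \<subseteq> pverts G \<and> (\<forall>u\<in>S. \<forall>v\<in>S. (u, v) \<notin> parcs G)"

text \<open>Only meaningful for graphs with finitely many vertices, where the maximum is taken over a
  finite set, nonempty because of the empty independent set.\<close>

definition independence_number :: "'a pair_pre_digraph \<Rightarrow> nat" where
  "independence_number G = Max (card ` {S. independent_set G S})"

end

theory Submission
  imports Defs "HOL-Number_Theory.Totient"
begin

text \<open>As \<open>n\<close> is squarefree, a prime \<open>p\<close> dividing \<open>n\<close> divides the order of \<open>x\<close> iff it does not divide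
  \<open>x\<close>. Two distinct elements are therefore nonadjacent iff two of the three primes divide neither of
  them. In an independent set with at least two elements, an element that is divisible by one of the
  primes forces the other two primes to divide no element of the set. Hence every such set consists of
  residues divisible by neither of two fixed primes \<open>p\<close>, \<open>q\<close>; there are \<open>r * (p - 1) * (q - 1)\<close> of
  these, where \<open>r\<close> is the third prime, and this is largest when \<open>r\<close> is the smallest prime.\<close>

text \<open>Coprimality to \<open>m\<close> depends only on the residue modulo \<open>m\<close>, so
  each of the \<open>k\<close> consecutive blocks of length \<open>m\<close> contributes
  \<open>totient m\<close> numbers.\<close>

lemma card_coprime_periodic:
  fixes k m :: nat
  assumes "m > 1"
  shows "card {x. x < k * m \<and> coprime x m} = k * totient m"
proof -
  let ?T = "totatives m"
  have "bij_betw (\<lambda>(j, x). j * m + x) ({..<k} \<times> ?T) {x. x < k * m \<and> coprime x m}"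
  proof (rule bij_betw_byWitness[where f' = "\<lambda>x. (x div m, x mod m)"])
    \<comment> \<open>Totatives range over 1 to \<open>m\<close>; since \<open>m > 1\<close>, the
      endpoint \<open>m\<close> is none, so they are proper residues.\<close>
    have less: "x < m" if "x \<in> ?T" for x
      using that assms totatives_less by blast
    show "\<forall>a\<in>{..<k} \<times> ?T. (\<lambda>x. (x div m, x mod m)) ((\<lambda>(j, x). j * m + x) a) = a"
      using less by (fastforce simp: div_mult_self3)
    show "(\<lambda>(j, x). j * m + x) ` ({..<k} \<times> ?T) \<subseteq> {x. x < k * m \<and> coprime x m}"
    proof clarsimp
      fix j x assume jx: "j < k" "x \<in> ?T"
      have "j * m + x < (j + 1) * m" using less[OF jx(2)] by simp
      also have "\<dots> \<le> k * m" using jx(1) by (intro mult_right_mono) auto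
      finally have "j * m + x < k * m" .
      moreover have "coprime (j * m + x) m"
        using jx(2) by (metis coprime_iff_gcd_eq_1 gcd.commute gcd_add_mult in_totatives_iff mult.commute add.commute)
      ultimately show "j * m + x < k * m \<and> coprime (j * m + x) m" by blast
    qed
    show "(\<lambda>x. (x div m, x mod m)) ` {x. x < k * m \<and> coprime x m} \<subseteq> {..<k} \<times> ?T"
    proof clarsimp
      fix x assume x: "x < k * m" "coprime x m"
      have c: "coprime (x mod m) m"
        using x(2) assms by simp
      hence "x mod m \<noteq> 0" using assms by (metis coprime_0_left_iff nat_dvd_1_iff_1 less_irrefl)
      thus "x div m < k \<and> x mod m \<in> ?T"
        using x c assms by (auto simp: in_totatives_iff less_mult_imp_div_less less_imp_le)
    qed
  qed simp
  from bij_betw_same_card[OF this] show ?thesis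
    by (simp add: card_cartesian_product totient_def)
qed

lemma prime_coprime_iff:
  fixes p x :: nat
  assumes "prime p"
  shows "coprime p x \<longleftrightarrow> \<not> p dvd x"
  using assms by (auto simp: prime_imp_coprime coprime_absorb_left)

text \<open>Avoiding both primes means being coprime to \<open>p * q\<close>, and \<open>n\<close>
  is \<open>r\<close> periods of length \<open>p * q\<close>.\<close>

lemma card_nondivisible_by_two_primes:
  fixes p q r :: nat
  assumes "prime p" "prime q" "p \<noteq> q" "n = p * q * r"
  shows "card {x \<in> {0..<int n}. \<not> int p dvd x \<and> \<not> int q dvd x} = r * (p - 1) * (q - 1)"
proof -
  have "{x \<in> {0..<int n}. \<not> int p dvd x \<and> \<not> int q dvd x}
      = int ` {x. x < r * (p * q) \<and> coprime x (p * q)}" (is "?A = _")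
  proof -
    have "coprime x (p * q) \<longleftrightarrow> \<not> p dvd x \<and> \<not> q dvd x" for x
      using assms(1,2)
      by (simp add: coprime_commute[of x] prime_coprime_iff)
    moreover have "\<exists>y. x = int y \<and> y < n \<and> \<not> p dvd y \<and> \<not> q dvd y" if "x \<in> ?A" for x
      using that by (cases x rule: int_cases2) auto
    moreover have "n = r * (p * q)" by (simp add: assms(4) mult_ac)
    ultimately have "{x. x < r * (p * q) \<and> coprime x (p * q)} = {y. y < n \<and> \<not> p dvd y \<and> \<not> q dvd y}"
      and "?A \<subseteq> int ` {y. y < n \<and> \<not> p dvd y \<and> \<not> q dvd y}"
      by (simp, blast)
    moreover have "int ` {y. y < n \<and> \<not> p dvd y \<and> \<not> q dvd y} \<subseteq> ?A" by auto
    ultimately show ?thesis by simp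
  qed
  hence "card ?A = card {x. x < r * (p * q) \<and> coprime x (p * q)}"
    by (simp add: card_image)
  also have "\<dots> = r * totient (p * q)"
    using assms prime_gt_1_nat[of p] prime_gt_1_nat[of q]
    by (intro card_coprime_periodic) (simp only: less_1_mult)
  also have "totient (p * q) = (p - 1) * (q - 1)"
    using assms by (simp add: totient_mult_coprime totient_prime primes_coprime)
  finally show ?thesis by simp
qed

text \<open>The \<open>k\<close>-th power of \<open>x\<close> in this additive group is
  \<open>k * x\<close> modulo \<open>n\<close>. Describing the order through its multiples avoids an
  explicit formula with a gcd.\<close>

lemma ord_integer_mod_group_dvd_iff:
  assumes "x \<in> carrier (integer_mod_group n)"
  shows "group.ord (integer_mod_group n) x dvd k \<longleftrightarrow> int n dvd int k * x"
  using group.pow_eq_id[OF group_integer_mod_group assms, of k]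
  by (simp add: dvd_eq_mod_eq_0)

text \<open>The prime \<open>r\<close> occurs exactly once in \<open>n\<close>, so the order, a
  divisor of \<open>r * m\<close>, avoids \<open>r\<close> iff it divides \<open>m\<close>, that is,
  iff \<open>r * m\<close> divides \<open>m * x\<close>.\<close>

lemma prime_dvd_ord_integer_mod_group_iff:
  assumes x: "x \<in> carrier (integer_mod_group n)"
    and n: "n = r * m" "n > 0" and r: "prime r" "\<not> r dvd m"
  shows "r dvd group.ord (integer_mod_group n) x \<longleftrightarrow> \<not> int r dvd x"
proof
  let ?o = "group.ord (integer_mod_group n) x"
  assume "r dvd ?o"
  show "\<not> int r dvd x"
  proof
    assume "int r dvd x"
    hence "int n dvd int m * x" by (simp add: n mult.commute mult_dvd_mono)
    hence "?o dvd m" by (simp add: ord_integer_mod_group_dvd_iff[OF x])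
    with \<open>r dvd ?o\<close> r(2) show False by (meson dvd_trans)
  qed
next
  let ?o = "group.ord (integer_mod_group n) x"
  assume nd: "\<not> int r dvd x"
  show "r dvd ?o"
  proof (rule ccontr)
    assume "\<not> r dvd ?o"
    hence "coprime ?o r" using r(1) by (simp add: coprime_commute prime_imp_coprime)
    moreover have "?o dvd r * m"
      using ord_integer_mod_group_dvd_iff[OF x, of n] n(1) by simp
    ultimately have "?o dvd m" by (simp add: coprime_dvd_mult_right_iff)
    hence "int r * int m dvd int m * x"
      using ord_integer_mod_group_dvd_iff[OF x] n(1) by (metis of_nat_mult)
    moreover have "m > 0" using n by simp
    ultimately have "int r dvd x" by (simp add: mult.commute)
    with nd show False by simp
  qed
qed

text \<open>Two distinct prime divisors rule out 1 and primes. Conversely, a divisor of the product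
  that misses two of the primes divides the third.\<close>

lemma not_one_or_prime_iff:
  fixes d p q r :: nat
  assumes "prime p" "prime q" "prime r" "p \<noteq> q" "p \<noteq> r" "q \<noteq> r" "d dvd p * q * r"
  shows "\<not> (d = 1 \<or> prime d) \<longleftrightarrow>
    p dvd d \<and> q dvd d \<or> p dvd d \<and> r dvd d \<or> q dvd d \<and> r dvd d"
proof -
  have two: "\<not> (d = 1 \<or> prime d)" if "prime a" "prime b" "a \<noteq> b" "a dvd d" "b dvd d" for a b :: nat
    using that by (metis nat_dvd_1_iff_1 primes_dvd_imp_eq)
  have one: "d = 1 \<or> prime d"
    if "prime a" "prime b" "prime c" "d dvd a * b * c" "\<not> a dvd d" "\<not> b dvd d" for a b c :: nat
  proof -
    have "coprime d a" "coprime d b"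
      using that by (simp_all add: coprime_commute prime_imp_coprime)
    hence "d dvd c"
      using that(4) by (simp add: coprime_dvd_mult_right_iff mult.assoc)
    thus ?thesis using that(3) by (metis prime_nat_iff)
  qed
  have "d dvd p * r * q" "d dvd q * r * p"
    using assms(7) by (simp_all add: mult_ac)
  with assms show ?thesis
    using two one[of p q r] one[of p r q] one[of q r p] by blast
qed

text \<open>The gcd of the orders divides \<open>n\<close>, and a prime of \<open>n\<close> divides
  it iff it divides neither residue. Distinctness matters: \<open>(u, u)\<close> is never an arc,
  yet the right-hand side fails for \<open>u = v = 0\<close>.\<close>

lemma nonadjacent_iff:
  assumes pr: "prime p" "prime q" "prime r" "p \<noteq> q" "p \<noteq> r" "q \<noteq> r"
    and n: "n = p * q * r"
    and u: "u \<in> carrier (integer_mod_group n)" and v: "v \<in> carrier (integer_mod_group n)"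
    and "u \<noteq> v"
  defines "B \<equiv> \<lambda>a b. \<not> int a dvd u \<and> \<not> int a dvd v \<and> \<not> int b dvd u \<and> \<not> int b dvd v"
  shows "(u, v) \<notin> parcs (prime_coprime_graph (integer_mod_group n)) \<longleftrightarrow> B p q \<or> B p r \<or> B q r"
proof -
  let ?ord = "group.ord (integer_mod_group n)"
  have n0: "n > 0" using pr by (simp add: n prime_gt_0_nat)
  have "?ord u dvd n"
    using ord_integer_mod_group_dvd_iff[OF u, of n] by simp
  hence d: "gcd (?ord u) (?ord v) dvd p * q * r"
    unfolding n by (rule dvd_trans[OF gcd_dvd1])
  have nd: "\<not> p dvd q * r" "\<not> q dvd p * r" "\<not> r dvd p * q"
    using pr by (auto simp: prime_dvd_mult_iff dest: primes_dvd_imp_eq)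
  have "s dvd ?ord x \<longleftrightarrow> \<not> int s dvd x"
    if "s \<in> {p, q, r}" "x \<in> carrier (integer_mod_group n)" for s x
    using prime_dvd_ord_integer_mod_group_iff[OF that(2) _ n0, of p "q * r"]
      prime_dvd_ord_integer_mod_group_iff[OF that(2) _ n0, of q "p * r"]
      prime_dvd_ord_integer_mod_group_iff[OF that(2) _ n0, of r "p * q"] that(1) pr nd n
    by (auto simp: mult_ac)
  hence "s dvd gcd (?ord u) (?ord v) \<longleftrightarrow> \<not> int s dvd u \<and> \<not> int s dvd v" if "s \<in> {p, q, r}" for s
    using that u v by simp
  thus ?thesis
    using not_one_or_prime_iff[OF pr d] u v \<open>u \<noteq> v\<close>
    by (auto simp: prime_coprime_graph_def B_def)
qed

text \<open>Singletons are excluded because \<open>{0}\<close> is independent but lies in none of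
  the three sets.\<close>

lemma independent_subset_cases:
  assumes pr: "prime p" "prime q" "prime r" "p \<noteq> q" "p \<noteq> r" "q \<noteq> r"
    and n: "n = p * q * r"
    and S: "independent_set (prime_coprime_graph (integer_mod_group n)) S"
    and ne: "\<not> card S \<le> 1"
  defines "B \<equiv> \<lambda>a b. {x \<in> {0..<int n}. \<not> int a dvd x \<and> \<not> int b dvd x}"
  shows "S \<subseteq> B p q \<or> S \<subseteq> B p r \<or> S \<subseteq> B q r"
proof -
  have n0: "n > 0" using pr by (simp add: n prime_gt_0_nat)
  have car: "carrier (integer_mod_group n) = {0..<int n}"
    using n0 by (simp add: carrier_integer_mod_group)
  have sub: "S \<subseteq> {0..<int n}"
    using S by (simp add: independent_set_def prime_coprime_graph_def car)
  have pair: "u \<in> B p q \<and> v \<in> B p q \<or> u \<in> B p r \<and> v \<in> B p r \<or> u \<in> B q r \<and> v \<in> B q r"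
    if "u \<in> S" "v \<in> S" "u \<noteq> v" for u v
    using nonadjacent_iff[OF pr n, of u v] S that sub
    unfolding independent_set_def car B_def by blast
  \<comment> \<open>Every element has a partner in \<open>S\<close>, so \<open>pair\<close> puts
    each element into at least one of the three sets.\<close>
  have other: "\<exists>v\<in>S. v \<noteq> u" for u
  proof (rule ccontr)
    assume "\<not> ?thesis"
    hence "S \<subseteq> {u}" by blast
    hence "card S \<le> 1" by (metis card_mono card.empty card_insert_disjoint finite.intros empty_iff One_nat_def)
    with ne show False by simp
  qed
  show ?thesis
  proof (rule ccontr)
    assume neg: "\<not> ?thesis"
    then obtain w where w: "w \<in> S" "w \<notin> B q r" by blast
    obtain v where v: "v \<in> S" "v \<noteq> w" using other by blast
    have "w \<in> B p q \<or> w \<in> B p r" using pair[OF w(1) v(1)] v w by blast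
    thus False
    proof
      assume "w \<in> B p q"
      \<comment> \<open>Being outside \<open>B q r\<close> but not divisible by \<open>q\<close>,
        \<open>w\<close> is divisible by \<open>r\<close>. Every pair containing \<open>w\<close>
        must therefore lie in \<open>B p q\<close>.\<close>
      hence "w \<notin> B p r" using w unfolding B_def by blast
      hence "S \<subseteq> B p q" using pair[OF w(1)] w \<open>w \<in> B p q\<close> by blast
      with neg show False by blast
    next
      assume "w \<in> B p r"
      hence "w \<notin> B p q" using w unfolding B_def by blast
      hence "S \<subseteq> B p r" using pair[OF w(1)] w \<open>w \<in> B p r\<close> by blast
      with neg show False by blast
    qed
  qed
qed

text \<open>Both sides start from \<open>a * b\<close>, and subtracting the larger \<open>b\<close>
  leaves less. This compares the three counts.\<close>

lemma mult_pred_le_mult_pred: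
  fixes a b c :: nat
  assumes "a \<le> b"
  shows "b * (a - 1) * c \<le> a * (b - 1) * c"
  using assms by (intro mult_right_mono) (auto simp: diff_mult_distrib2 mult.commute)

theorem proposition3p13:
  fixes n p1 p2 p3 :: nat
  assumes "prime p1" and "prime p2" and "prime p3"
    and "p1 < p2" and "p2 < p3"
    and "n = p1 * p2 * p3"
  shows "independence_number (prime_coprime_graph (integer_mod_group n))
    = p1 * (p2 - 1) * (p3 - 1)"
proof -
  let ?G = "prime_coprime_graph (integer_mod_group n)"
  let ?B = "\<lambda>a b. {x \<in> {0..<int n}. \<not> int a dvd x \<and> \<not> int b dvd x}"
  have ne: "p1 \<noteq> p2" "p1 \<noteq> p3" "p2 \<noteq> p3" using assms by auto
  have gt: "p1 > 1" "p2 > 1" "p3 > 1" using assms prime_gt_1_nat by auto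
  have car: "carrier (integer_mod_group n) = {0..<int n}"
    using assms gt by (simp add: carrier_integer_mod_group)
  have c: "card (?B p1 p2) = p3 * (p1 - 1) * (p2 - 1)" "card (?B p1 p3) = p2 * (p1 - 1) * (p3 - 1)"
    "card (?B p2 p3) = p1 * (p2 - 1) * (p3 - 1)"
    using assms ne by (intro card_nondivisible_by_two_primes; simp add: mult_ac)+
  have "independent_set ?G (?B p2 p3)"
    unfolding independent_set_def
  proof (intro conjI ballI)
    show "?B p2 p3 \<subseteq> pverts ?G" by (auto simp: prime_coprime_graph_def car)
    fix u v assume "u \<in> ?B p2 p3" "v \<in> ?B p2 p3"
    thus "(u, v) \<notin> parcs ?G"
      using nonadjacent_iff[OF assms(1-3) ne assms(6), of u v]
      \<comment> \<open>Independence also quantifies over equal vertices, where the graph has no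
        loops.\<close>
      by (cases "u = v") (auto simp: car prime_coprime_graph_def)
  qed
  moreover have "card S \<le> p1 * (p2 - 1) * (p3 - 1)" if S: "independent_set ?G S" for S
  proof (cases "card S \<le> 1")
    case True
    \<comment> \<open>Sets with at most one element escape the case distinction, but the bound is at
      least 1.\<close>
    have "0 < p1 * (p2 - 1) * (p3 - 1)" using gt by simp
    with True show ?thesis by linarith
  next
    case False
    \<comment> \<open>Exchanging the leading prime for the smaller \<open>p1\<close> increases the
      product, so \<open>?B p2 p3\<close> is the largest.\<close>
    have "card (?B p1 p2) \<le> card (?B p2 p3)"
      unfolding c using mult_pred_le_mult_pred[of p1 p3 "p2 - 1"] assms(4,5) by (simp add: mult_ac)
    moreover have "card (?B p1 p3) \<le> card (?B p2 p3)"
      unfolding c using mult_pred_le_mult_pred[of p1 p2 "p3 - 1"] assms(4) by simp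
    moreover have "card S \<le> card (?B a b)" if "S \<subseteq> ?B a b" for a b
      by (rule card_mono[OF finite_subset[of _ "{0..<int n}"] that]) auto
    ultimately show ?thesis
      using independent_subset_cases[OF assms(1-3) ne assms(6) S False] c(3)
      by (metis (no_types, lifting) le_trans)
  qed
  moreover have "finite {S. independent_set ?G S}"
    by (rule finite_subset[of _ "Pow {0..<int n}"])
      (auto simp: independent_set_def prime_coprime_graph_def car)
  ultimately show ?thesis
    unfolding independence_number_def c(3)[symmetric]
    by (intro Max_eqI) auto
qed

end
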